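(* For any finite nonempty sets $\mathcal{W}_1,\ldots,\mathcal{W}_n\subset\mathbb{R}^n$, $T(\mathcal{W}_1,\ldots,\mathcal{W}_n)\le\prod_{i=1}^n(|\mathcal{W}_i|-1)$; that is, the Kouchnirenko bound holds for the number of nondegenerate positive solutions of tropical polynomial systems (equivalently, of real polynomial systems obtained by combinatorial patchworking) with supports $\mathcal{W}_1,\ldots,\mathcal{W}_n$.
   Context: Let $P_i=\mathrm{conv}\,\mathcal{W}_i$. Given $\mu_i:\mathcal{W}_i\to\mathbb{R}$, let $\hat P_i=\mathrm{conv}\{(w,\mu_i(w))\}\subset\mathbb{R}^{n+1}$, $\hat P=\sum_i\hat P_i$; projecting the lower faces of $\hat P$ (faces where some $\langle u,\cdot\rangle$ with $u$ having positive last coordinate is minimized) gives the convex mixed subdivision $\mathcal{S}$ of $P=\sum P_i$, each $Q\in\mathcal{S}$ written $Q=Q_1+\cdots+Q_n$ with $Q_i$ the projection of the face of $\hat P_i$ where the same function is minimized; similarly $\mu_i$ alone gives the convex subdivision $\mathcal{S}_i$ of $P_i$. $\mathcal{S}$ is pure if $\dim Q=\sum\dim Q_i$ for all $Q\in\mathcal{S}$. A mixed polytope is $Q\in\mathcal{S}$ of dimension $n$ with each $Q_i$ a segment. Given sign maps $\sigma_i:\mathcal{W}_i\to\{+1,-1\}$, a mixed polytope is nonempty if for every $i$ the endpoints of $Q_i$ have opposite signs under $\sigma_i$. $T(\mathcal{W}_1,\ldots,\mathcal{W}_n)$ is the maximum, over all $\mu_i,\sigma_i$ such that each $\mathcal{S}_i$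 is a triangulation of $P_i$ with vertex set $\mathcal{W}_i$ and $\mathcal{S}$ is pure, of the number of nonempty mixed polytopes of $\mathcal{S}$. *)

theory Defs
  imports "HOL-Analysis.Analysis"
begin

text \<open>Index set {1..n} and coordinates of R^n are both modelled by the finite type 'n.
  A lower face direction u = (v, c) with c > 0 is normalised to c = 1, i.e. u = (v,1).
  The face of the lifted polytope conv{(w, mu_i w)} minimising u is the convex hull of the
  lifted points of the minimising subset of W_i; its projection is the convex hull of that subset.\<close>

definition lower_argmin :: "(real^'n) set \<Rightarrow> (real^'n \<Rightarrow> real) \<Rightarrow> real^'n \<Rightarrow> (real^'n) set" where
  "lower_argmin W mu v = {w \<in> W. \<forall>w'\<in>W. v \<bullet> w + mu w \<le> v \<bullet> w' + mu w'}"

definition subdiv_cells :: "(real^'n) set \<Rightarrow> (real^'n \<Rightarrow> real) \<Rightarrow> (real^'n) set set" where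
  "subdiv_cells W mu = {convex hull (lower_argmin W mu v) | v. True}"

definition is_triangulation_with_vertices ::
  "(real^'n) set \<Rightarrow> (real^'n \<Rightarrow> real) \<Rightarrow> bool" where
  "is_triangulation_with_vertices W mu \<longleftrightarrow>
     (\<forall>Q\<in>subdiv_cells W mu. \<exists>m. m simplex Q) \<and>
     (\<Union>Q\<in>subdiv_cells W mu. {x. x extreme_point_of Q}) = W"

text \<open>Cells of the mixed subdivision S, each given with its decomposition (Q_1,...,Q_n).\<close>
definition mixed_cells ::
  "('i \<Rightarrow> (real^'n) set) \<Rightarrow> ('i \<Rightarrow> real^'n \<Rightarrow> real) \<Rightarrow> ('i \<Rightarrow> (real^'n) set) set" where
  "mixed_cells W mu = {(\<lambda>i. convex hull (lower_argmin (W i) (mu i) v)) | v. True}"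

definition minkowski_sum :: "('i::finite \<Rightarrow> (real^'n) set) \<Rightarrow> (real^'n) set" where
  "minkowski_sum Q = {x. \<exists>f. (\<forall>i. f i \<in> Q i) \<and> x = (\<Sum>i\<in>UNIV. f i)}"

definition pure_mixed :: "('i::finite \<Rightarrow> (real^'n) set) \<Rightarrow> ('i \<Rightarrow> real^'n \<Rightarrow> real) \<Rightarrow> bool" where
  "pure_mixed W mu \<longleftrightarrow>
     (\<forall>Q\<in>mixed_cells W mu. aff_dim (minkowski_sum Q) = (\<Sum>i\<in>UNIV. aff_dim (Q i)))"

definition is_mixed_polytope :: "('i::finite \<Rightarrow> (real^'n) set) \<Rightarrow> bool" where
  "is_mixed_polytope Q \<longleftrightarrow> aff_dim (minkowski_sum Q) = int CARD('n) \<and>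
     (\<forall>i. \<exists>a b. a \<noteq> b \<and> Q i = closed_segment a b)"

definition nonempty_mixed ::
  "('i \<Rightarrow> real^'n \<Rightarrow> int) \<Rightarrow> ('i::finite \<Rightarrow> (real^'n) set) \<Rightarrow> bool" where
  "nonempty_mixed sg Q \<longleftrightarrow>
     (\<forall>i. \<exists>a b. a \<noteq> b \<and> Q i = closed_segment a b \<and> sg i a \<noteq> sg i b)"

definition num_nonempty_mixed ::
  "('i::finite \<Rightarrow> (real^'n) set) \<Rightarrow> ('i \<Rightarrow> real^'n \<Rightarrow> real) \<Rightarrow> ('i \<Rightarrow> real^'n \<Rightarrow> int) \<Rightarrow> nat" where
  "num_nonempty_mixed W mu sg =
     card {Q\<in>mixed_cells W mu. is_mixed_polytope Q \<and> nonempty_mixed sg Q}"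

end

theory Submission
  imports Defs
begin

text \<open>Attach to a mixed cell with edges \<open>[a\<^sub>i, b\<^sub>i]\<close> the tensor \<open>\<Otimes>\<^sub>i (e\<^bsub>a\<^sub>i\<^esub> - e\<^bsub>b\<^sub>i\<^esub>)\<close>. It lies in the tensor product
  of the spaces of functions on \<open>W\<^sub>i\<close> with zero sum, which has dimension \<open>\<Prod>\<^sub>i (|W\<^sub>i| - 1)\<close>, so it
  suffices that these tensors are linearly independent. Fix a generic vector \<open>\<xi>\<close>. The cell is dual
  to a point \<open>v\<close>, and among the \<open>2\<^sup>n\<close> choices \<open>c\<^sub>i \<in> {a\<^sub>i, b\<^sub>i}\<close> there is one for which \<open>v\<close> is the
  only minimum of \<open>\<xi>\<close> on the polyhedron of points where every \<open>c\<^sub>i\<close> attains the minimum over \<open>W\<^sub>i\<close>.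
  A tensor with a nonzero entry at \<open>c\<close> belongs to a point of that polyhedron, so the matrix of
  entries at these \<open>c\<close> is triangular with respect to the values of \<open>\<xi>\<close>, with diagonal entries \<open>\<plusminus>1\<close>.\<close>

section \<open>Homogeneous linear systems and functions with zero marginals\<close>

lemma homogeneous_system_nontrivial_solution:
  fixes u :: "'q \<Rightarrow> 'x \<Rightarrow> 'f::field"
  assumes "finite X" "finite Q" "card X < card Q"
  shows "\<exists>\<alpha>. (\<exists>q\<in>Q. \<alpha> q \<noteq> 0) \<and> (\<forall>x\<in>X. (\<Sum>q\<in>Q. \<alpha> q * u q x) = 0)"
  using assms
proof (induction X arbitrary: Q u rule: finite_induct)
  case empty
  then have "Q \<noteq> {}" by auto
  then show ?case by (intro exI[of _ "\<lambda>_. 1"]) auto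
next
  case (insert y X)
  show ?case
  proof (cases "\<exists>p\<in>Q. u p y \<noteq> 0")
    case False
    have "card X < card Q" using insert by simp
    with insert.IH[OF insert.prems(1)] obtain \<alpha> where
      "\<exists>q\<in>Q. \<alpha> q \<noteq> 0" "\<forall>x\<in>X. (\<Sum>q\<in>Q. \<alpha> q * u q x) = 0" by blast
    then show ?thesis using False by (intro exI[of _ \<alpha>]) auto
  next
    case True
    then obtain p where p: "p \<in> Q" "u p y \<noteq> 0" by blast
    \<comment> \<open>Elimination with pivot \<open>p\<close>: equation \<open>y\<close> is solved
      for the unknown of \<open>p\<close> and substituted into the others, which leaves the
      coefficients \<open>u'\<close>.\<close>
    define u' where "u' q x = u q x - u q y / u p y * u p x" for q x
    have "card X < card (Q - {p})" using insert p by simp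
    with insert.IH[of "Q - {p}" u'] insert.prems obtain \<beta> where
      nz: "\<exists>q\<in>Q - {p}. \<beta> q \<noteq> 0" and eq: "\<And>x. x \<in> X \<Longrightarrow> (\<Sum>q\<in>Q - {p}. \<beta> q * u' q x) = 0"
      by auto
    define \<alpha> where "\<alpha> = \<beta>(p := - (\<Sum>q\<in>Q - {p}. \<beta> q * u q y) / u p y)"
    have expand: "(\<Sum>q\<in>Q. \<alpha> q * u q x) = (\<Sum>q\<in>Q - {p}. \<beta> q * u' q x)" for x
    proof -
      have "(\<Sum>q\<in>Q. \<alpha> q * u q x) = \<alpha> p * u p x + (\<Sum>q\<in>Q - {p}. \<alpha> q * u q x)"
        using insert.prems p by (simp add: sum.remove)
      also have "(\<Sum>q\<in>Q - {p}. \<alpha> q * u q x) = (\<Sum>q\<in>Q - {p}. \<beta> q * u q x)"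
        by (rule sum.cong) (auto simp: \<alpha>_def)
      also have "\<alpha> p * u p x = - (\<Sum>q\<in>Q - {p}. \<beta> q * (u q y / u p y * u p x))"
        by (simp add: \<alpha>_def sum_distrib_right sum_divide_distrib mult.assoc)
      finally show ?thesis
        by (simp add: u'_def right_diff_distrib sum_subtractf)
    qed
    have "(\<Sum>q\<in>Q. \<alpha> q * u q y) = 0"
      unfolding expand using p by (simp add: u'_def)
    moreover have "\<exists>q\<in>Q. \<alpha> q \<noteq> 0" using nz by (auto simp: \<alpha>_def)
    ultimately show ?thesis using eq expand by (intro exI[of _ \<alpha>]) auto
  qed
qed

text \<open>If \<open>x i = w0 i\<close>, a vanishing marginal expresses \<open>g x\<close> as minus
  the sum of the values at the points whose coordinate \<open>i\<close> is moved elsewhere in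
  \<open>W i\<close>. Those points agree with \<open>w0\<close> in fewer coordinates, so induction
  applies. This is how the dimension bound for the space of tensors enters.\<close>

lemma zero_marginals_determined:
  fixes g :: "('n::finite \<Rightarrow> 'a) \<Rightarrow> 'b::ab_group_add"
  assumes fin: "\<And>i. finite (W i)"
    and marginal: "\<And>i x. (\<Sum>w\<in>W i. g (x(i := w))) = 0"
    and zero: "\<And>x. (\<And>i. x i \<in> W i - {w0 i}) \<Longrightarrow> g x = 0"
    and x: "\<And>i. x i \<in> W i"
  shows "g x = 0"
  using x
proof (induction "card {i. x i = w0 i}" arbitrary: x rule: less_induct)
  case less
  show ?case
  proof (cases "\<exists>i. x i = w0 i")
    case False
    then show ?thesis using less.prems zero by auto
  next
    case True
    then obtain i where i: "x i = w0 i" by blast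
    have "g (x(i := w)) = 0" if "w \<in> W i - {x i}" for w
    proof (rule less.hyps)
      show "card {j. (x(i := w)) j = w0 j} < card {j. x j = w0 j}"
        using that i by (intro psubset_card_mono) (auto split: if_splits)
      show "(x(i := w)) j \<in> W j" for j using that less.prems by auto
    qed
    moreover have "g (x(i := x i)) + (\<Sum>w\<in>W i - {x i}. g (x(i := w))) = 0"
      using marginal[of x i] less.prems[of i] fin by (simp add: sum.remove[of "W i" "x i"] del: fun_upd_triv)
    ultimately show ?thesis by simp
  qed
qed

section \<open>Tensors of edge tuples and their independence\<close>

definition edge_tensor :: "('n::finite \<Rightarrow> 'a) \<Rightarrow> ('n \<Rightarrow> 'a) \<Rightarrow> ('n \<Rightarrow> 'a) \<Rightarrow> real" where
  "edge_tensor a b x = (\<Prod>i\<in>UNIV. of_bool (x i = a i) - of_bool (x i = b i))"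

lemma edge_tensor_nonzero_iff:
  "edge_tensor a b x \<noteq> 0 \<longleftrightarrow> (\<forall>i. a i \<noteq> b i \<and> (x i = a i \<or> x i = b i))"
proof -
  have "(of_bool (x i = a i) - of_bool (x i = b i) :: real) \<noteq> 0 \<longleftrightarrow>
      a i \<noteq> b i \<and> (x i = a i \<or> x i = b i)" for i
    by (cases "x i = a i"; cases "x i = b i") auto
  then show ?thesis by (simp add: edge_tensor_def)
qed

text \<open>Only the factor at \<open>i\<close> depends on \<open>w\<close>, and over
  \<open>V\<close> its entries +1 and -1 cancel.\<close>

lemma edge_tensor_marginal:
  assumes "finite V" "a i \<in> V" "b i \<in> V"
  shows "(\<Sum>w\<in>V. edge_tensor a b (x(i := w))) = 0"
proof -
  have "edge_tensor a b (x(i := w)) = (of_bool (w = a i) - of_bool (w = b i)) *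
      (\<Prod>j\<in>UNIV - {i}. of_bool (x j = a j) - of_bool (x j = b j))" for w
    unfolding edge_tensor_def by (subst prod.remove[of UNIV i]) (auto intro!: prod.cong)
  moreover have "(\<Sum>w\<in>V. of_bool (w = a i) - of_bool (w = b i) :: real) = 0"
    using assms by (simp add: sum_subtractf of_bool_def)
  ultimately show ?thesis by (simp flip: sum_distrib_right)
qed

text \<open>With too many tensors there would be a nontrivial linear relation. Among the indices
  with nonzero coefficient take \<open>p\<close> with \<open>h p\<close> largest: by triangularity
  every other tensor in the relation vanishes at \<open>c p\<close>, while that of \<open>p\<close>
  does not.\<close>

lemma triangular_edge_tensors_card_le:
  fixes a b c :: "'q \<Rightarrow> 'n::finite \<Rightarrow> 'a" and h :: "'q \<Rightarrow> real"
  assumes fin: "finite Q" "\<And>i. finite (W i)" and ne: "\<And>i. W i \<noteq> {}"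
    and ab: "\<And>q i. q \<in> Q \<Longrightarrow> a q i \<in> W i \<and> b q i \<in> W i \<and> a q i \<noteq> b q i"
    and c: "\<And>q i. q \<in> Q \<Longrightarrow> c q i = a q i \<or> c q i = b q i"
    and tri: "\<And>p q. p \<in> Q \<Longrightarrow> q \<in> Q \<Longrightarrow> p \<noteq> q \<Longrightarrow>
                (\<And>i. c p i = a q i \<or> c p i = b q i) \<Longrightarrow> h p < h q"
  shows "card Q \<le> (\<Prod>i\<in>UNIV. card (W i) - 1)"
proof (rule ccontr)
  assume less: "\<not> card Q \<le> (\<Prod>i\<in>UNIV. card (W i) - 1)"
  have "\<forall>i. \<exists>w. w \<in> W i" using ne by blast
  then obtain w0 where w0: "\<And>i. w0 i \<in> W i" by metis
  \<comment> \<open>One reference element is removed from each factor, so \<open>card X\<close> is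
    exactly the bound, and a combination of the tensors that vanishes on \<open>X\<close> vanishes
    on the whole product.\<close>
  define X where "X = (\<Pi>\<^sub>E i\<in>UNIV. W i - {w0 i})"
  have "card X = (\<Prod>i\<in>UNIV. card (W i) - 1)"
    using w0 fin by (simp add: X_def card_PiE)
  moreover have "finite X" unfolding X_def using fin by (intro finite_PiE) auto
  ultimately obtain \<alpha> where nz: "\<exists>q\<in>Q. \<alpha> q \<noteq> 0"
    and X0: "\<And>x. x \<in> X \<Longrightarrow> (\<Sum>q\<in>Q. \<alpha> q * edge_tensor (a q) (b q) x) = 0"
    using homogeneous_system_nontrivial_solution[of X Q "\<lambda>q. edge_tensor (a q) (b q)"] less fin
    by auto
  define g where "g x = (\<Sum>q\<in>Q. \<alpha> q * edge_tensor (a q) (b q) x)" for x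
  have g0: "g x = 0" if "\<And>i. x i \<in> W i" for x
  proof (rule zero_marginals_determined[where W = W and ?w0.0 = w0])
    show "(\<Sum>w\<in>W i. g (x(i := w))) = 0" for i x
    proof -
      have "(\<Sum>w\<in>W i. g (x(i := w))) =
          (\<Sum>q\<in>Q. \<alpha> q * (\<Sum>w\<in>W i. edge_tensor (a q) (b q) (x(i := w))))"
        unfolding g_def by (subst sum.swap) (simp add: sum_distrib_left)
      also have "\<dots> = 0"
        using fin ab by (intro sum.neutral ballI) (simp add: edge_tensor_marginal)
      finally show ?thesis .
    qed
    show "g x = 0" if "\<And>i. x i \<in> W i - {w0 i}" for x
      using X0[of x] that by (simp add: X_def g_def PiE_def)
  qed (use fin that in auto)
  define P where "P = {q\<in>Q. \<alpha> q \<noteq> 0}"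
  have "finite P" "P \<noteq> {}" using fin nz by (auto simp: P_def)
  then obtain p where p: "p \<in> P" and max: "\<And>q. q \<in> P \<Longrightarrow> h q \<le> h p"
    using Max_in[of "h ` P"] Max_ge[of "h ` P"] by fastforce
  have pQ: "p \<in> Q" "\<alpha> p \<noteq> 0" using p by (auto simp: P_def)
  have "\<alpha> q * edge_tensor (a q) (b q) (c p) = 0" if "q \<in> Q - {p}" for q
  proof (rule ccontr)
    assume "\<alpha> q * edge_tensor (a q) (b q) (c p) \<noteq> 0"
    then have "\<alpha> q \<noteq> 0" "\<And>i. c p i = a q i \<or> c p i = b q i"
      by (auto simp: edge_tensor_nonzero_iff)
    then show False using tri[of p q] pQ that max[of q] by (auto simp: P_def)
  qed
  then have "(\<Sum>q\<in>Q - {p}. \<alpha> q * edge_tensor (a q) (b q) (c p)) = 0" by (intro sum.neutral ballI)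
  then have "g (c p) = \<alpha> p * edge_tensor (a p) (b p) (c p)"
    using pQ fin by (simp add: g_def sum.remove[of Q p])
  moreover have "g (c p) = 0" using c[OF pQ(1)] ab[OF pQ(1)] by (intro g0) metis
  moreover have "edge_tensor (a p) (b p) (c p) \<noteq> 0"
    using c[OF pQ(1)] ab[OF pQ(1)] by (auto simp: edge_tensor_nonzero_iff)
  ultimately show False using pQ by simp
qed

section \<open>Edge directions of full-dimensional cells and generic vectors\<close>

lemma span_directions_of_full_dim_minkowski_sum:
  fixes a b :: "'i::finite \<Rightarrow> real^'n"
  assumes "\<And>i. Q i = closed_segment (a i) (b i)"
    and "aff_dim (minkowski_sum Q) = int CARD('n)"
  shows "span (range (\<lambda>i. b i - a i)) = UNIV"
proof -
  let ?D = "span (range (\<lambda>i. b i - a i))"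
  \<comment> \<open>The sum of the segments lies in a translate of the span of their directions, so
    full dimension forces that span to be the whole space.\<close>
  have "minkowski_sum Q \<subseteq> (+) (\<Sum>i\<in>UNIV. a i) ` ?D"
  proof
    fix x assume "x \<in> minkowski_sum Q"
    then obtain f where f: "\<And>i. f i \<in> closed_segment (a i) (b i)" and x: "x = (\<Sum>i\<in>UNIV. f i)"
      using assms(1) by (auto simp: minkowski_sum_def)
    have "\<exists>s. f i = a i + s *\<^sub>R (b i - a i)" for i
      using f[of i] by (auto simp: in_segment algebra_simps)
    then obtain s where s: "\<And>i. f i = a i + s i *\<^sub>R (b i - a i)" by metis
    have "x = (\<Sum>i\<in>UNIV. a i) + (\<Sum>i\<in>UNIV. s i *\<^sub>R (b i - a i))"
      unfolding x s by (simp add: sum.distrib)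
    moreover have "(\<Sum>i\<in>UNIV. s i *\<^sub>R (b i - a i)) \<in> ?D"
      by (intro span_sum span_scale span_base) auto
    ultimately show "x \<in> (+) (\<Sum>i\<in>UNIV. a i) ` ?D" by blast
  qed
  then have "int CARD('n) \<le> aff_dim ((+) (\<Sum>i\<in>UNIV. a i) ` ?D)"
    using aff_dim_subset assms(2) by metis
  then have "CARD('n) \<le> dim ?D" by (simp add: aff_dim_translation_eq aff_dim_subspace)
  then have "dim (range (\<lambda>i. b i - a i)) = DIM(real^'n)"
    using dim_subset_UNIV[of "range (\<lambda>i. b i - a i)"] by simp
  then show ?thesis by (simp only: dim_eq_full)
qed

text \<open>Each of these spans is generated by at most n - 1 vectors, hence is a null set, and
  finitely many null sets do not cover the space.\<close>

lemma generic_vector_avoids_coordinate_hyperplanes: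
  fixes d :: "'q \<Rightarrow> 'n::finite \<Rightarrow> real^'n"
  assumes "finite Q"
  obtains \<xi> where "\<And>q i. q \<in> Q \<Longrightarrow> \<xi> \<notin> span (d q ` (UNIV - {i}))"
proof -
  have "negligible (\<Union>q\<in>Q. \<Union>i\<in>UNIV. span (d q ` (UNIV - {i})))"
  proof (intro negligible_Union finite_imageI ballI assms; clarify)
    have "dim (d q ` (UNIV - {i})) < DIM(real^'n)" for q i
    proof -
      have "dim (d q ` (UNIV - {i})) \<le> card (UNIV - {i})"
        by (rule order_trans[OF dim_le_card' card_image_le]) auto
      also have "\<dots> < CARD('n)" by (simp add: card_gt_0_iff)
      finally show ?thesis by simp
    qed
    then show "negligible (\<Union>i\<in>UNIV. span (d q ` (UNIV - {i})))" for q
      by (intro negligible_Union) (auto intro: negligible_lowdim)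
  qed
  then have "(\<Union>q\<in>Q. \<Union>i\<in>UNIV. span (d q ` (UNIV - {i}))) \<noteq> UNIV"
    using non_negligible_UNIV by metis
  then show thesis using that by blast
qed

text \<open>A coefficient equal to 0 would put \<open>\<xi>\<close> into the span of the remaining
  directions.\<close>

lemma generic_vector_full_support:
  fixes d :: "'n::finite \<Rightarrow> real^'n"
  assumes "span (range d) = UNIV" "\<And>i. \<xi> \<notin> span (d ` (UNIV - {i}))"
  obtains l where "\<xi> = (\<Sum>i\<in>UNIV. l i *\<^sub>R d i)" "\<And>i. l i \<noteq> 0"
proof -
  have "\<xi> \<in> span (range d)" using assms by simp
  moreover have "span (range d) = range (\<lambda>l. \<Sum>i\<in>UNIV. l i *\<^sub>R d i)"
  proof
    show "range (\<lambda>l. \<Sum>i\<in>UNIV. l i *\<^sub>R d i) \<subseteq> span (range d)"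
      by (auto intro!: span_sum intro: span_scale span_base)
    have "d i = (\<Sum>j\<in>UNIV. of_bool (j = i) *\<^sub>R d j)" for i
      by (simp add: sum.remove[of UNIV i])
    then have "range d \<subseteq> range (\<lambda>l. \<Sum>i\<in>UNIV. l i *\<^sub>R d i)"
      by (intro image_subsetI) (rule range_eqI)
    moreover have "subspace (range (\<lambda>l. \<Sum>i\<in>UNIV. l i *\<^sub>R d i))"
    proof (rule subspaceI)
      show "0 \<in> range (\<lambda>l. \<Sum>i\<in>UNIV. l i *\<^sub>R d i)"
        by (rule range_eqI[of _ _ "\<lambda>_. 0"]) simp
    next
      fix x y assume "x \<in> range (\<lambda>l. \<Sum>i\<in>UNIV. l i *\<^sub>R d i)" "y \<in> range (\<lambda>l. \<Sum>i\<in>UNIV. l i *\<^sub>R d i)"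
      then obtain l m where "x = (\<Sum>i\<in>UNIV. l i *\<^sub>R d i)" "y = (\<Sum>i\<in>UNIV. m i *\<^sub>R d i)" by blast
      then show "x + y \<in> range (\<lambda>l. \<Sum>i\<in>UNIV. l i *\<^sub>R d i)"
        by (intro range_eqI[of _ _ "\<lambda>i. l i + m i"]) (simp add: scaleR_add_left sum.distrib)
    next
      fix r x assume "x \<in> range (\<lambda>l. \<Sum>i\<in>UNIV. l i *\<^sub>R d i)"
      then obtain l where "x = (\<Sum>i\<in>UNIV. l i *\<^sub>R d i)" by blast
      then show "r *\<^sub>R x \<in> range (\<lambda>l. \<Sum>i\<in>UNIV. l i *\<^sub>R d i)"
        by (intro range_eqI[of _ _ "\<lambda>i. r * l i"]) (simp add: scaleR_sum_right)
    qed
    ultimately show "span (range d) \<subseteq> range (\<lambda>l. \<Sum>i\<in>UNIV. l i *\<^sub>R d i)"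
      by (rule span_minimal)
  qed
  ultimately obtain l where l: "\<xi> = (\<Sum>i\<in>UNIV. l i *\<^sub>R d i)" by blast
  have "l i \<noteq> 0" for i
  proof
    assume "l i = 0"
    then have "\<xi> = (\<Sum>j\<in>UNIV - {i}. l j *\<^sub>R d j)" unfolding l by (simp add: sum.remove[of UNIV i])
    then have "\<xi> \<in> span (d ` (UNIV - {i}))" by (auto intro!: span_sum intro: span_scale span_base)
    then show False using assms by blast
  qed
  with l show thesis using that by blast
qed

text \<open>The inner product is a sum of nonnegative terms, and a nonzero \<open>x\<close> cannot
  be orthogonal to all vectors of a spanning family, so some term is positive. It yields strict
  minimality of a linear functional at the apex of a cone.\<close>

lemma inner_positive_combination_pos:
  fixes d :: "'n::finite \<Rightarrow> 'a::euclidean_space"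
  assumes "span (range d) = UNIV" "\<And>i. l i \<noteq> 0" "\<And>i. 0 \<le> l i * (x \<bullet> d i)" "x \<noteq> 0"
  shows "0 < x \<bullet> (\<Sum>i\<in>UNIV. l i *\<^sub>R d i)"
proof -
  have "\<exists>i. x \<bullet> d i \<noteq> 0"
  proof (rule ccontr)
    assume "\<nexists>i. x \<bullet> d i \<noteq> 0"
    then have "orthogonal x y" if "y \<in> range d" for y using that by (auto simp: orthogonal_def)
    then have "orthogonal x x" using assms(1) orthogonal_to_span[of x "range d" x] by auto
    then show False using assms by (simp add: orthogonal_self)
  qed
  then have "0 < (\<Sum>i\<in>UNIV. l i * (x \<bullet> d i))"
    using assms by (metis (no_types, lifting) UNIV_I finite less_eq_real_def mult_eq_0_iff sum_pos2)
  then show ?thesis by (simp add: inner_sum_right)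
qed

text \<open>The endpoints are extreme points of the hull, and extreme points of
  \<open>convex hull A\<close> belong to \<open>A\<close>.\<close>

lemma segment_hull_endpoints:
  fixes a b :: "'a::euclidean_space"
  assumes "convex hull A = closed_segment a b"
  shows "a \<in> A" "b \<in> A"
  using assms extreme_point_of_convex_hull[of a A] extreme_point_of_convex_hull[of b A]
  by (simp_all add: extreme_point_of_segment)

section \<open>Ordering the mixed cells by a generic functional\<close>

theorem theorem1p6:
  fixes W :: "'n::finite \<Rightarrow> (real^'n) set"
    and mu :: "'n \<Rightarrow> real^'n \<Rightarrow> real"
    and sg :: "'n \<Rightarrow> real^'n \<Rightarrow> int"
  assumes "\<And>i. finite (W i)" and "\<And>i. W i \<noteq> {}"
    and "\<And>i w. w \<in> W i \<Longrightarrow> sg i w \<in> {1, -1}"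
    and "\<And>i. is_triangulation_with_vertices (W i) (mu i)"
    and "pure_mixed W mu"
  shows "num_nonempty_mixed W mu sg \<le> (\<Prod>i\<in>UNIV. card (W i) - 1)"
proof -
  define C where "C = {Q\<in>mixed_cells W mu. is_mixed_polytope Q \<and> nonempty_mixed sg Q}"
  have "card C \<le> (\<Prod>i\<in>UNIV. card (W i) - 1)"
  proof (cases "finite C")
    \<comment> \<open>An infinite set has \<open>card\<close> 0.\<close>
    case False
    then show ?thesis by simp
  next
    case True
    let ?M = "\<lambda>v i. lower_argmin (W i) (mu i) v"
    have "\<exists>v. Q = (\<lambda>i. convex hull ?M v i)" if "Q \<in> C" for Q
      using that by (auto simp: C_def mixed_cells_def)
    then obtain v where v: "\<And>Q. Q \<in> C \<Longrightarrow> Q = (\<lambda>i. convex hull ?M (v Q) i)"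
      by (metis (lifting))
    have full: "aff_dim (minkowski_sum Q) = int CARD('n)" if "Q \<in> C" for Q
      using that by (simp add: C_def is_mixed_polytope_def)
    have "\<forall>Q i. \<exists>e. Q \<in> C \<longrightarrow> fst e \<noteq> snd e \<and> Q i = closed_segment (fst e) (snd e)"
      by (auto simp: C_def is_mixed_polytope_def)
    then obtain e where e: "\<And>Q i. Q \<in> C \<Longrightarrow> fst (e Q i) \<noteq> snd (e Q i) \<and> Q i = closed_segment (fst (e Q i)) (snd (e Q i))"
      by metis
    define a b where "a Q i = fst (e Q i)" and "b Q i = snd (e Q i)" for Q i
    have ab: "a Q i \<noteq> b Q i \<and> Q i = closed_segment (a Q i) (b Q i)" if "Q \<in> C" for Q i
      using e[OF that] by (simp add: a_def b_def)
    define d where "d Q i = b Q i - a Q i" for Q i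
    have abM: "a Q i \<in> ?M (v Q) i" "b Q i \<in> ?M (v Q) i" if "Q \<in> C" for Q i
    proof -
      have "convex hull ?M (v Q) i = closed_segment (a Q i) (b Q i)"
        using ab[OF that, of i] fun_cong[OF v[OF that], of i] by simp
      then show "a Q i \<in> ?M (v Q) i" "b Q i \<in> ?M (v Q) i"
        by (rule segment_hull_endpoints)+
    qed
    have spanning: "span (range (d Q)) = UNIV" if "Q \<in> C" for Q
      using span_directions_of_full_dim_minkowski_sum[of Q "a Q" "b Q"] ab full that
      by (simp add: d_def[abs_def])
    obtain \<xi> where "\<And>Q i. Q \<in> C \<Longrightarrow> \<xi> \<notin> span (d Q ` (UNIV - {i}))"
      using generic_vector_avoids_coordinate_hyperplanes[OF True] by blast
    then have "\<forall>Q\<in>C. \<exists>l. \<xi> = (\<Sum>i\<in>UNIV. l i *\<^sub>R d Q i) \<and> (\<forall>i. l i \<noteq> 0)"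
      using spanning generic_vector_full_support by metis
    then obtain l where l: "\<And>Q. Q \<in> C \<Longrightarrow> \<xi> = (\<Sum>i\<in>UNIV. l Q i *\<^sub>R d Q i)"
      and l0: "\<And>Q i. Q \<in> C \<Longrightarrow> l Q i \<noteq> 0"
      by metis
    \<comment> \<open>The sign of \<open>l Q i\<close> decides the endpoint so that
      \<open>l Q i * ((x - v Q) \<bullet> d Q i)\<close> is nonnegative at every \<open>x\<close>
      for which \<open>c Q i\<close> attains the minimum over \<open>W i\<close>. Hence
      \<open>\<xi>\<close> strictly increases from \<open>v Q\<close> to any other \<open>x\<close>
      where this holds for all \<open>i\<close>.\<close>
    define c where "c Q i = (if l Q i > 0 then a Q i else b Q i)" for Q i
    have "v P \<bullet> \<xi> < v Q \<bullet> \<xi>"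
      if P: "P \<in> C" and Q: "Q \<in> C" and "P \<noteq> Q" and cP: "\<And>i. c P i = a Q i \<or> c P i = b Q i" for P Q
    proof -
      \<comment> \<open>A cell is recovered from its dual point, so distinct cells have distinct
        points.\<close>
      have "v P \<noteq> v Q" using v[OF P] v[OF Q] \<open>P \<noteq> Q\<close> by auto
      moreover have "0 \<le> l P i * ((v Q - v P) \<bullet> d P i)" for i
      proof -
        have cQ: "c P i \<in> ?M (v Q) i" using cP[of i] abM[OF Q] by metis
        then have "v Q \<bullet> c P i + mu i (c P i) \<le> v Q \<bullet> a P i + mu i (a P i)"
          "v Q \<bullet> c P i + mu i (c P i) \<le> v Q \<bullet> b P i + mu i (b P i)"
          using abM[OF P, of i] by (auto simp: lower_argmin_def)
        \<comment> \<open>At \<open>v P\<close> the two endpoints tie; subtracting this from the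
          inequalities at \<open>v Q\<close> cancels the values of \<open>mu i\<close> and leaves
          the sign of \<open>(v Q - v P) \<bullet> d P i\<close>.\<close>
        moreover have "v P \<bullet> a P i + mu i (a P i) = v P \<bullet> b P i + mu i (b P i)"
          using abM[OF P, of i] by (auto simp: lower_argmin_def intro: antisym)
        ultimately show ?thesis using l0[OF P, of i]
          by (cases "l P i > 0")
            (auto simp: c_def d_def zero_le_mult_iff inner_diff_left inner_diff_right)
      qed
      ultimately have "0 < (v Q - v P) \<bullet> \<xi>"
        using inner_positive_combination_pos[OF spanning[OF P] l0[OF P]] l[OF P] by auto
      then show ?thesis by (simp add: inner_diff_left)
    qed
    then show ?thesis
      using triangular_edge_tensors_card_le[of C W a b c "\<lambda>Q. v Q \<bullet> \<xi>"] True assms(1,2) ab abM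
      by (auto simp: c_def lower_argmin_def)
  qed
  then show ?thesis by (simp add: num_nonempty_mixed_def C_def)
qed

end
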